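(* Let $G=(V,E)$ be a finite connected graph with $|V|\ge 2$ whose edge lengths all lie in an interval $[\ell_{min},\ell_{max}]$ with $0<\ell_{min}\le \ell_{max}<\infty$, and let $r_e=\ell_{max}/\ell_{min}$. Let $1\le k\le |V|$, let $S=\{s_1,\dots,s_k\}$ be a set of sources returned by the Farthest Point Sampling algorithm on $G$, and let $S^*=\{s^*_1,\dots,s^*_k\}$ be a set of $k$ vertices minimizing the stretch factor $\max_{p,q\in V,\,p\ne q} D_{S'}(p,q)/d(p,q)$ over all sets $S'$ of $k$ vertices. Then \[\max_{p,q\in V,\,p\neq q}\frac{D_S(p,q)}{d(p,q)}\;\le\; 2r_e^2\max_{p,q\in V,\,p\ne q}\frac{D_{S^*}(p,q)}{d(p,q)}+2r_e^2+8r_e+1.\]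
   Context: For vertices $p,q$, $d(p,q)$ denotes the shortest-path distance in the edge-weighted graph $G$ (each edge has a positive length). For a nonempty set $S$ of vertices (called sources), $D_S(p,q)=\min_{s\in S}\bigl(d(p,s)+d(s,q)\bigr)$ is the length of a shortest path from $p$ to $q$ through some source in $S$. Farthest Point Sampling (FPS): pick an arbitrary vertex as the first source; then, until $k$ sources are picked, iteratively add a vertex whose distance to its closest already picked source is largest among all vertices (ties broken arbitrarily). The statement holds for every possible output of FPS. *)

theory Defs
  imports "Graph_Theory.Graph_Theory"
begin

text \<open>
  As usual for \<open>Graph_Theory\<close>, a finite simple undirected graph is a finite symmetric digraph
  without loops and parallel arcs (locale \<^locale>\<open>graph\<close>): every edge is a pair of opposite arcs.
  A length function on the undirected edges must therefore agree on opposite arcs.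
\<close>

locale edge_weighted_graph = graph G for G :: "('a, 'b) pre_digraph" (structure) +
  fixes w :: "'b weight_fun"
  assumes weight_sym:
    "\<lbrakk>e \<in> arcs G; e' \<in> arcs G; tail G e = head G e'; head G e = tail G e'\<rbrakk> \<Longrightarrow> w e = w e'"
    and weight_pos: "e \<in> arcs G \<Longrightarrow> 0 < w e"

text \<open>
  The library's distance is extended-real valued. In a connected graph with positive weights
  it is finite, so nothing is lost by passing to the reals.
\<close>

definition graph_dist :: "('a, 'b) pre_digraph \<Rightarrow> 'b weight_fun \<Rightarrow> 'a \<Rightarrow> 'a \<Rightarrow> real" where
  "graph_dist G w p q = real_of_ereal (wf_digraph.\<mu> G w p q)"

definition via_dist ::
  "('a, 'b) pre_digraph \<Rightarrow> 'b weight_fun \<Rightarrow> 'a set \<Rightarrow> 'a \<Rightarrow> 'a \<Rightarrow> real" where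
  "via_dist G w S p q = Min ((\<lambda>s. graph_dist G w p s + graph_dist G w s q) ` S)"

definition stretch :: "('a, 'b) pre_digraph \<Rightarrow> 'b weight_fun \<Rightarrow> 'a set \<Rightarrow> real" where
  "stretch G w S =
     Max {via_dist G w S p q / graph_dist G w p q | p q. p \<in> verts G \<and> q \<in> verts G \<and> p \<noteq> q}"

definition dist_to_sources ::
  "('a, 'b) pre_digraph \<Rightarrow> 'b weight_fun \<Rightarrow> 'a set \<Rightarrow> 'a \<Rightarrow> real" where
  "dist_to_sources G w S v = Min ((\<lambda>s. graph_dist G w v s) ` S)"

text \<open>
  \<open>fps_run G w xs\<close>: the list \<open>xs\<close> is a possible sequence of sources picked by Farthest Point
  Sampling, in the order in which they are picked.
\<close>

inductive fps_run :: "('a, 'b) pre_digraph \<Rightarrow> 'b weight_fun \<Rightarrow> 'a list \<Rightarrow> bool"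
  for G :: "('a, 'b) pre_digraph" and w :: "'b weight_fun" where
  first: "v \<in> verts G \<Longrightarrow> fps_run G w [v]"
| add: "fps_run G w xs \<Longrightarrow>
    is_arg_max (dist_to_sources G w (set xs)) (\<lambda>u. u \<in> verts G) v \<Longrightarrow>
    fps_run G w (xs @ [v])"

definition fps_output :: "('a, 'b) pre_digraph \<Rightarrow> 'b weight_fun \<Rightarrow> nat \<Rightarrow> 'a set \<Rightarrow> bool" where
  "fps_output G w k S \<longleftrightarrow> (\<exists>xs. fps_run G w xs \<and> length xs = k \<and> S = set xs)"

definition optimal_sources ::
  "('a, 'b) pre_digraph \<Rightarrow> 'b weight_fun \<Rightarrow> nat \<Rightarrow> 'a set \<Rightarrow> bool" where
  "optimal_sources G w k S \<longleftrightarrow> is_arg_min (stretch G w) (\<lambda>S'. S' \<subseteq> verts G \<and> card S' = k) S"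

end

theory Submission
  imports Defs
begin

text \<open>
  Let \<open>R\<close> be the covering radius of the sources \<open>S\<close> found by Farthest Point Sampling.
  Those \<open>k\<close> sources and a vertex farthest from them are at pairwise distance at least \<open>R\<close>,
  so by pigeonhole and the triangle inequality any \<open>k\<close> sources \<open>T\<close> leave a vertex \<open>u\<close> at
  distance at least \<open>R/2\<close>. A detour from \<open>u\<close> to a neighbour through \<open>T\<close> has length at least
  \<open>R - l_max\<close>, hence \<open>R \<le> l_max * (stretch T + 1)\<close>. Conversely, a detour through \<open>S\<close> exceeds
  the distance by at most \<open>2 * R\<close>, so \<open>stretch S \<le> 1 + 2 * R / l_min\<close>. Together this gives
  the stronger bound \<open>2 * r_e * stretch T + 2 * r_e + 1\<close>.
\<close>

locale connected_edge_weighted_graph = edge_weighted_graph +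
  assumes connected: "Digraph_Component.connected G"
begin

abbreviation d :: "'a \<Rightarrow> 'a \<Rightarrow> real" where
  "d \<equiv> graph_dist G w"

section \<open>Shortest-path distance as a metric on the vertices\<close>

lemma reachable_in_connected:
  assumes "u \<in> verts G" "v \<in> verts G"
  shows "u \<rightarrow>\<^sup>* v"
  using strongly_connectedE[OF symmetric_connected_imp_strongly_connected[OF sym_arcs connected]] assms
  by blast

text \<open>Nonnegative lengths make the cheapest walk exist, so the extended-real
  \<open>\<mu>\<close> is an actual walk cost and \<open>real_of_ereal\<close> loses nothing. Later
  distance bounds argue with this witness walk.\<close>

lemma graph_dist_attained:
  assumes "u \<in> verts G" "v \<in> verts G"
  obtains p where "awalk u p v" "d u v = awalk_cost w p"
proof -
  obtain p where "apath u p v" "\<mu> w u v = awalk_cost w p"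
    using min_cost_awalk[OF reachable_in_connected[OF assms], of w] weight_pos less_imp_le by blast
  then show thesis
    by (intro that[of p]) (simp_all add: graph_dist_def apath_def)
qed

lemma graph_dist_le_awalk_cost:
  assumes "awalk u p v"
  shows "d u v \<le> awalk_cost w p"
proof -
  have "u \<rightarrow>\<^sup>* v"
    using assms unfolding reachable_awalk by blast
  then obtain q where q: "\<mu> w u v = awalk_cost w q"
    using min_cost_awalk[of u v w] weight_pos less_imp_le by metis
  show ?thesis
    using min_cost_le_walk_cost[OF assms, of w] unfolding graph_dist_def q by simp
qed

lemma graph_dist_nonneg:
  assumes "u \<in> verts G" "v \<in> verts G"
  shows "0 \<le> d u v"
  using graph_dist_attained[OF assms] pos_cost_pos_awalk_cost weight_pos less_imp_le by metis

lemma graph_dist_self: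
  assumes "u \<in> verts G"
  shows "d u u = 0"
  using graph_dist_le_awalk_cost[of u "[]" u] graph_dist_nonneg[OF assms assms] assms
  by (simp add: awalk_Nil_iff)

lemma graph_dist_triangle:
  assumes "u \<in> verts G" "v \<in> verts G" "x \<in> verts G"
  shows "d u v \<le> d u x + d x v"
proof -
  obtain p where p: "awalk u p x" "d u x = awalk_cost w p"
    using graph_dist_attained assms by blast
  obtain q where q: "awalk x q v" "d x v = awalk_cost w q"
    using graph_dist_attained assms by blast
  show ?thesis
    using graph_dist_le_awalk_cost[OF awalk_appendI[OF p(1) q(1)]] p(2) q(2) by simp
qed

text \<open>Every arc has an opposite arc, of the same length by \<open>weight_sym\<close>. The
  induction reverses the tail of the walk and appends the opposite of its first arc.\<close>

lemma reverse_awalk: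
  assumes "awalk u p v"
  shows "\<exists>q. awalk v q u \<and> awalk_cost w q = awalk_cost w p"
  using assms
proof (induction p arbitrary: u)
  case Nil
  then show ?case
    by (intro exI[of _ "[]"]) (auto simp: awalk_Nil_iff)
next
  case (Cons e p)
  then have e: "e \<in> arcs G" "u = tail G e" "awalk (head G e) p v"
    by (auto simp: awalk_Cons_iff)
  obtain q where q: "awalk v q (head G e)" "awalk_cost w q = awalk_cost w p"
    using Cons.IH[OF e(3)] by blast
  obtain e' where e': "e' \<in> arcs G" "tail G e = head G e'" "head G e = tail G e'"
    using sym_arcs e(1) unfolding symmetric_conv by blast
  have "awalk v (q @ [e']) u"
    using q(1) e' e(1,2) by (intro awalk_appendI[OF q(1)]) (simp add: awalk_Cons_iff awalk_Nil_iff)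
  moreover have "awalk_cost w (q @ [e']) = awalk_cost w (e # p)"
    using q(2) weight_sym[OF e(1) e'] by simp
  ultimately show ?case
    by blast
qed

lemma graph_dist_commute:
  assumes "u \<in> verts G" "v \<in> verts G"
  shows "d u v = d v u"
proof -
  have "d x y \<le> d y x" if "x \<in> verts G" "y \<in> verts G" for x y
    using graph_dist_attained[OF that(2,1)] reverse_awalk graph_dist_le_awalk_cost by metis
  then show ?thesis
    using assms by (simp add: antisym)
qed

text \<open>The first arc of a shortest walk is a witness, since the rest of the walk has
  nonnegative cost. This yields positivity of the distance and, later, the lower bound by the least
  edge length.\<close>

lemma graph_dist_ge_weight:
  assumes "u \<in> verts G" "v \<in> verts G" "u \<noteq> v"
  obtains e where "e \<in> arcs G" "w e \<le> d u v"
proof -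
  obtain p where p: "awalk u p v" "d u v = awalk_cost w p"
    using graph_dist_attained assms by blast
  then obtain e q where eq: "p = e # q"
    using assms(3) by (cases p) (auto simp: awalk_Nil_iff)
  then have e: "e \<in> arcs G" "awalk (head G e) q v"
    using p(1) by (auto simp: awalk_Cons_iff)
  have "0 \<le> awalk_cost w q"
    using pos_cost_pos_awalk_cost[OF e(2)] weight_pos less_imp_le by blast
  then show thesis
    using that[OF e(1)] p(2) eq by simp
qed

lemma graph_dist_pos:
  assumes "u \<in> verts G" "v \<in> verts G" "u \<noteq> v"
  shows "0 < d u v"
  using graph_dist_ge_weight[OF assms] weight_pos by (metis less_le_trans)

lemma neighbour_exists:
  assumes "card (verts G) \<ge> 2" "u \<in> verts G"
  obtains e where "e \<in> arcs G" "tail G e = u"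
proof -
  obtain v where "v \<in> verts G" "v \<noteq> u"
    using assms by (metis card_le_Suc0_iff_eq finite_verts not_less_eq_eq numeral_2_eq_2)
  then obtain p where "awalk u p v" "p \<noteq> []"
    using reachable_in_connected[OF assms(2)] unfolding reachable_awalk
    by (metis awalk_Nil_iff)
  then show thesis
    using that by (cases p) (auto simp: awalk_Cons_iff)
qed

section \<open>Minima over source sets and the maximum defining the stretch\<close>

lemma finite_sources:
  assumes "S \<subseteq> verts G"
  shows "finite S"
  using assms finite_verts by (rule finite_subset)

lemma dist_to_sources_le:
  assumes "S \<subseteq> verts G" "s \<in> S"
  shows "dist_to_sources G w S v \<le> d v s"
  unfolding dist_to_sources_def using finite_sources[OF assms(1)] assms(2) by simp

lemma dist_to_sources_attained:
  assumes "S \<subseteq> verts G" "S \<noteq> {}"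
  obtains s where "s \<in> S" "dist_to_sources G w S v = d v s"
proof -
  have "dist_to_sources G w S v \<in> (\<lambda>s. d v s) ` S"
    unfolding dist_to_sources_def using finite_sources[OF assms(1)] assms(2)
    by (intro Min_in) auto
  then show thesis using that by blast
qed

lemma dist_to_sources_antimono:
  assumes "S \<subseteq> T" "T \<subseteq> verts G" "S \<noteq> {}"
  shows "dist_to_sources G w T v \<le> dist_to_sources G w S v"
  unfolding dist_to_sources_def using finite_sources[OF assms(2)] assms
  by (intro Min_antimono) auto

lemma via_dist_le:
  assumes "S \<subseteq> verts G" "s \<in> S"
  shows "via_dist G w S p q \<le> d p s + d s q"
  unfolding via_dist_def using finite_sources[OF assms(1)] assms(2) by simp

lemma via_dist_attained:
  assumes "S \<subseteq> verts G" "S \<noteq> {}"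
  obtains s where "s \<in> S" "via_dist G w S p q = d p s + d s q"
proof -
  have "via_dist G w S p q \<in> (\<lambda>s. d p s + d s q) ` S"
    unfolding via_dist_def using finite_sources[OF assms(1)] assms(2)
    by (intro Min_in) auto
  then show thesis using that by blast
qed

lemma finite_stretch_set:
  "finite {via_dist G w S p q / d p q | p q. p \<in> verts G \<and> q \<in> verts G \<and> p \<noteq> q}"
proof (rule finite_subset)
  show "{via_dist G w S p q / d p q | p q. p \<in> verts G \<and> q \<in> verts G \<and> p \<noteq> q}
      \<subseteq> (\<lambda>(p, q). via_dist G w S p q / d p q) ` (verts G \<times> verts G)"
    by auto
qed simp

lemma stretch_ge:
  assumes "p \<in> verts G" "q \<in> verts G" "p \<noteq> q"
  shows "via_dist G w S p q / d p q \<le> stretch G w S"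
  unfolding stretch_def using finite_stretch_set assms by (intro Max_ge) auto

lemma stretch_le:
  assumes "card (verts G) \<ge> 2"
    and "\<And>p q. p \<in> verts G \<Longrightarrow> q \<in> verts G \<Longrightarrow> p \<noteq> q \<Longrightarrow> via_dist G w S p q / d p q \<le> c"
  shows "stretch G w S \<le> c"
proof -
  \<comment> \<open>Two distinct vertices make the set under \<open>Max\<close> nonempty, as
    \<open>Max_le_iff\<close> demands.\<close>
  have "\<exists>p q. p \<in> verts G \<and> q \<in> verts G \<and> p \<noteq> q"
    using assms(1) by (metis card_le_Suc0_iff_eq finite_verts not_less_eq_eq numeral_2_eq_2)
  then show ?thesis
    unfolding stretch_def using finite_stretch_set assms(2) by (subst Max_le_iff) auto
qed

section \<open>Farthest Point Sampling as a 2-approximation of the covering radius\<close>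

lemma fps_run_sources:
  assumes "fps_run G w xs"
  shows "xs \<noteq> [] \<and> set xs \<subseteq> verts G"
  using assms
proof induction
  case (add xs v)
  then show ?case
    unfolding is_arg_max_def by simp
qed simp

text \<open>When \<open>a\<close> is picked it is at least as far from the earlier picks as
  \<open>v\<close> is, and the distance of \<open>v\<close> to the sources only shrinks afterwards,
  so old separations persist. \<open>sorted_wrt\<close> compares positions, so repeated vertices are
  covered too.\<close>

lemma fps_run_separated:
  assumes "fps_run G w xs" "v \<in> verts G"
  shows "sorted_wrt (\<lambda>x y. dist_to_sources G w (set xs) v \<le> d x y) xs"
  using assms
proof (induction arbitrary: v)
  case (first u)
  then show ?case by simp
next
  case (add xs a)
  have xs: "xs \<noteq> []" "set xs \<subseteq> verts G"
    using fps_run_sources[OF add.hyps(1)] by auto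
  have a: "a \<in> verts G" "dist_to_sources G w (set xs) v \<le> dist_to_sources G w (set xs) a"
    using add.hyps(2) add.prems unfolding is_arg_max_linorder by blast+
  have le: "dist_to_sources G w (set (xs @ [a])) v \<le> dist_to_sources G w (set xs) v"
    using xs a(1) by (intro dist_to_sources_antimono) auto
  have "dist_to_sources G w (set (xs @ [a])) v \<le> d x a" if "x \<in> set xs" for x
    using le a dist_to_sources_le[OF xs(2) that, of a] graph_dist_commute[of x a] that xs(2)
    by auto
  moreover have "sorted_wrt (\<lambda>x y. dist_to_sources G w (set (xs @ [a])) v \<le> d x y) xs"
    by (rule sorted_wrt_mono_rel[OF _ add.IH[OF add.prems]]) (use le in linarith)
  ultimately show ?case
    unfolding sorted_wrt_append by simp
qed

lemma fps_run_two_approx: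
  assumes run: "fps_run G w xs" and v: "v \<in> verts G"
    and T: "T \<subseteq> verts G" "T \<noteq> {}" "card T \<le> length xs"
  obtains u where "u \<in> verts G" "dist_to_sources G w (set xs) v \<le> 2 * dist_to_sources G w T u"
proof -
  define r where "r = dist_to_sources G w (set xs) v"
  have xs: "xs \<noteq> []" "set xs \<subseteq> verts G"
    using fps_run_sources[OF run] by auto
  have "\<exists>u\<in>verts G. r \<le> 2 * dist_to_sources G w T u"
  \<comment> \<open>For \<open>r \<le> 0\<close> the vertex \<open>v\<close> itself serves as
    \<open>u\<close>. Positivity of \<open>r\<close> is what makes the list \<open>xs @ [v]\<close>
    distinct below.\<close>
  proof (cases "r \<le> 0")
    case True
    obtain s where "s \<in> T" "dist_to_sources G w T v = d v s"
      using dist_to_sources_attained[OF T(1,2)] by metis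
    then have "0 \<le> dist_to_sources G w T v"
      using graph_dist_nonneg v T(1) by auto
    then show ?thesis
      using True v by force
  next
    case False
    have vs: "set (xs @ [v]) \<subseteq> verts G"
      using xs v by simp
    have "r \<le> d x v" if "x \<in> set xs" for x
      using dist_to_sources_le[OF xs(2) that, of v] graph_dist_commute[of x v] that xs(2) v
      by (auto simp: r_def)
    then have sep: "sorted_wrt (\<lambda>x y. r \<le> d x y) (xs @ [v])"
      using fps_run_separated[OF run v] by (simp add: sorted_wrt_append r_def)
    have "distinct (xs @ [v])"
      unfolding distinct_conv_nth
    proof (intro allI impI)
      fix i j
      assume ij: "i < length (xs @ [v])" "j < length (xs @ [v])" "i \<noteq> j"
      \<comment> \<open>A vertex occurring at two positions would have distance 0 to itself, yet at
        least \<open>r > 0\<close> by separation.\<close>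
      have ne: "(xs @ [v]) ! m \<noteq> (xs @ [v]) ! n" if mn: "m < n" "n < length (xs @ [v])" for m n
      proof
        assume eq: "(xs @ [v]) ! m = (xs @ [v]) ! n"
        have "r \<le> d ((xs @ [v]) ! m) ((xs @ [v]) ! n)"
          using sorted_wrt_nth_less[OF sep mn] .
        moreover have "(xs @ [v]) ! n \<in> verts G"
          using vs nth_mem[OF mn(2)] by blast
        ultimately show False
          using False graph_dist_self eq by metis
      qed
      show "(xs @ [v]) ! i \<noteq> (xs @ [v]) ! j"
        using ne[of i j] ne[of j i] ij by (cases i j rule: linorder_cases) auto
    qed
    then have card: "card (set (xs @ [v])) = Suc (length xs)"
      using distinct_card by fastforce
    \<comment> \<open>Pigeonhole: \<open>f\<close> sends each of the \<open>Suc (length xs)\<close>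
      separated vertices to a nearest source in \<open>T\<close>, and \<open>T\<close> has at most
      \<open>length xs\<close> elements.\<close>
    have "\<forall>x. \<exists>s. s \<in> T \<and> dist_to_sources G w T x = d x s"
      using dist_to_sources_attained[OF T(1,2)] by blast
    then obtain f where f: "\<And>x. f x \<in> T" "\<And>x. dist_to_sources G w T x = d x (f x)"
      by metis
    have "card (f ` set (xs @ [v])) \<le> card T"
      using f(1) finite_sources[OF T(1)] by (intro card_mono) auto
    then have "\<not> inj_on f (set (xs @ [v]))"
      using card T(3) card_image[of f "set (xs @ [v])"] by linarith
    then obtain x y where xy: "x \<in> set (xs @ [v])" "y \<in> set (xs @ [v])" "x \<noteq> y" "f x = f y"
      unfolding inj_on_def by blast
    then have xy_verts: "x \<in> verts G" "y \<in> verts G" "f x \<in> verts G"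
      using vs f(1)[of x] T(1) by auto
    have "r \<le> d x y"
    proof -
      obtain i j where ij: "i < length (xs @ [v])" "x = (xs @ [v]) ! i"
          "j < length (xs @ [v])" "y = (xs @ [v]) ! j"
        using xy(1,2) unfolding in_set_conv_nth by metis
      \<comment> \<open>Separation speaks only of an earlier against a later position, and the order
        of \<open>x\<close> and \<open>y\<close> is unknown; symmetry of \<open>d\<close> removes
        the ambiguity.\<close>
      then have "r \<le> d x y \<or> r \<le> d y x"
        using sorted_wrt_nth_less[OF sep, of i j] sorted_wrt_nth_less[OF sep, of j i] xy(3)
        by (cases i j rule: linorder_cases) auto
      then show ?thesis
        using graph_dist_commute xy_verts by metis
    qed
    also have "d x y \<le> d x (f x) + d (f x) y"
      using graph_dist_triangle xy_verts by blast
    also have "\<dots> = dist_to_sources G w T x + dist_to_sources G w T y"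
      using f(2) xy(4) graph_dist_commute xy_verts by simp
    finally have "r \<le> 2 * dist_to_sources G w T x \<or> r \<le> 2 * dist_to_sources G w T y"
      by linarith
    then show ?thesis
      using xy_verts by blast
  qed
  then show thesis
    using that r_def by blast
qed

section \<open>Trading covering radius against stretch\<close>

lemma radius_le_stretch:
  assumes card: "card (verts G) \<ge> 2" and T: "T \<subseteq> verts G" "T \<noteq> {}"
    and u: "u \<in> verts G" and l: "\<And>e. e \<in> arcs G \<Longrightarrow> w e \<le> l"
  shows "2 * dist_to_sources G w T u \<le> l * (stretch G w T + 1)"
proof -
  obtain e where e: "e \<in> arcs G" "tail G e = u"
    using neighbour_exists[OF card u] .
  define x where "x = head G e"
  have x: "x \<in> verts G" "u \<noteq> x"
    using e no_loops by (auto simp: x_def)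
  have "awalk u [e] x"
    using e x_def by (auto intro: arc_implies_awalk)
  then have "d u x \<le> l"
    using graph_dist_le_awalk_cost[of u "[e]" x] l[OF e(1)] by simp
  have pos: "0 < d u x"
    using graph_dist_pos u x by blast
  obtain s where s: "s \<in> T" "via_dist G w T u x = d u s + d s x"
    using via_dist_attained[OF T] .
  \<comment> \<open>The return leg from \<open>s\<close> to \<open>x\<close> is shorter than the
    outward leg by at most \<open>d u x\<close>, so the detour costs almost twice the distance of
    \<open>u\<close> to \<open>T\<close>.\<close>
  have "d u s \<le> d s x + d u x"
    using graph_dist_triangle[of u s x] graph_dist_commute[of s x] s(1) T(1) u x by auto
  then have via: "2 * dist_to_sources G w T u \<le> via_dist G w T u x + d u x"
    using s dist_to_sources_le[OF T(1) s(1), of u] by linarith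
  have stretch: "via_dist G w T u x / d u x \<le> stretch G w T"
    using stretch_ge u x by blast
  have "0 \<le> via_dist G w T u x"
    using s graph_dist_nonneg u x T(1) by auto
  \<comment> \<open>The sign is needed to replace the factor \<open>d u x\<close> by
    \<open>l\<close> at the end.\<close>
  then have "0 \<le> stretch G w T"
    using stretch pos by (meson divide_nonneg_pos order_trans)
  have "2 * dist_to_sources G w T u \<le> d u x * (stretch G w T + 1)"
    using via stretch pos by (simp add: field_simps)
  also have "\<dots> \<le> l * (stretch G w T + 1)"
    using \<open>d u x \<le> l\<close> \<open>0 \<le> stretch G w T\<close> by (intro mult_right_mono) auto
  finally show ?thesis .
qed

text \<open>Going through the source nearest to \<open>p\<close> adds at most \<open>2 * r\<close>
  to the distance. Relative to a distance of at least \<open>l\<close>, this excess is at most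
  \<open>2 * r / l\<close>.\<close>

lemma stretch_le_radius:
  assumes card: "card (verts G) \<ge> 2" and S: "S \<subseteq> verts G" "S \<noteq> {}"
    and r: "\<And>v. v \<in> verts G \<Longrightarrow> dist_to_sources G w S v \<le> r"
    and l: "0 < l" "\<And>e. e \<in> arcs G \<Longrightarrow> l \<le> w e"
  shows "stretch G w S \<le> 1 + 2 * r / l"
proof (rule stretch_le[OF card])
  fix p q
  assume pq: "p \<in> verts G" "q \<in> verts G" "p \<noteq> q"
  obtain s where s: "s \<in> S" "dist_to_sources G w S p = d p s"
    using dist_to_sources_attained[OF S] .
  have ps: "0 \<le> d p s" "d p s \<le> r"
    using s r[OF pq(1)] graph_dist_nonneg pq(1) S(1) by auto
  have "d s q \<le> d p s + d p q"
    using graph_dist_triangle[of s q p] graph_dist_commute[of s p] s(1) S(1) pq by auto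
  then have via: "via_dist G w S p q \<le> 2 * r + d p q"
    using via_dist_le[OF S(1) s(1), of p q] ps by linarith
  have lpq: "l \<le> d p q"
    using graph_dist_ge_weight[OF pq] l(2) by (metis order_trans)
  have "via_dist G w S p q / d p q \<le> (2 * r + d p q) / d p q"
    using via lpq l(1) by (intro divide_right_mono) auto
  also have "\<dots> = 1 + 2 * r / d p q"
    using lpq l(1) by (simp add: field_simps)
  \<comment> \<open>Enlarging the fraction by shrinking its denominator uses
    \<open>0 \<le> r\<close>, which follows from \<open>ps\<close>.\<close>
  also have "\<dots> \<le> 1 + 2 * r / l"
    using lpq l(1) ps by (intro add_left_mono divide_left_mono) auto
  finally show "via_dist G w S p q / d p q \<le> 1 + 2 * r / l" .
qed

text \<open>Lets the final theorem multiply \<open>r_e \<le> r_e\<^sup>2\<close> by the optimal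
  stretch.\<close>

lemma stretch_nonneg:
  assumes "card (verts G) \<ge> 2" "T \<subseteq> verts G" "T \<noteq> {}"
  shows "0 \<le> stretch G w T"
proof -
  obtain p q where pq: "p \<in> verts G" "q \<in> verts G" "p \<noteq> q"
    using assms(1) by (metis card_le_Suc0_iff_eq finite_verts not_less_eq_eq numeral_2_eq_2)
  obtain s where "s \<in> T" "via_dist G w T p q = d p s + d s q"
    using via_dist_attained[OF assms(2,3)] .
  then have "0 \<le> via_dist G w T p q / d p q"
    using graph_dist_nonneg pq assms(2) by (auto intro!: divide_nonneg_nonneg add_nonneg_nonneg)
  then show ?thesis
    using stretch_ge[OF pq, of T] by linarith
qed

theorem fps_stretch_le:
  assumes card: "card (verts G) \<ge> 2"
    and l: "0 < l_min" "\<And>e. e \<in> arcs G \<Longrightarrow> w e \<in> {l_min..l_max}"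
    and run: "fps_run G w xs"
    and T: "T \<subseteq> verts G" "T \<noteq> {}" "card T \<le> length xs"
  shows "stretch G w (set xs) \<le> 2 * (l_max / l_min) * stretch G w T + 2 * (l_max / l_min) + 1"
proof -
  \<comment> \<open>The factor 2 lost by sampling is exactly the factor 2 on the left of
    \<open>radius_le_stretch\<close>, so the two cancel.\<close>
  have "dist_to_sources G w (set xs) v \<le> l_max * (stretch G w T + 1)" if v: "v \<in> verts G" for v
  proof -
    obtain u where "u \<in> verts G"
        "dist_to_sources G w (set xs) v \<le> 2 * dist_to_sources G w T u"
      using fps_run_two_approx[OF run v T] .
    moreover have "w e \<le> l_max" if "e \<in> arcs G" for e
      using l(2)[OF that] by simp
    ultimately show ?thesis
      using radius_le_stretch[OF card T(1,2)] by fastforce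
  qed
  moreover have "l_min \<le> w e" if "e \<in> arcs G" for e
    using l(2)[OF that] by simp
  ultimately have "stretch G w (set xs) \<le> 1 + 2 * (l_max * (stretch G w T + 1)) / l_min"
    using stretch_le_radius[OF card] fps_run_sources[OF run] l(1) by blast
  then show ?thesis
    by (simp add: algebra_simps add_divide_distrib)
qed

end

theorem theorem1:
  fixes G :: "('a, 'b) pre_digraph" and w :: "'b \<Rightarrow> real"
    and l_min l_max r_e :: real and k :: nat and S S_opt :: "'a set"
  assumes "edge_weighted_graph G w"
    and "Digraph_Component.connected G"
    and "card (verts G) \<ge> 2"
    and "0 < l_min" and "l_min \<le> l_max"
    and "\<And>e. e \<in> arcs G \<Longrightarrow> w e \<in> {l_min..l_max}"
    and "r_e = l_max / l_min"
    and "1 \<le> k" and "k \<le> card (verts G)"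
    and "fps_output G w k S"
    and "optimal_sources G w k S_opt"
  shows "stretch G w S \<le> 2 * r_e\<^sup>2 * stretch G w S_opt + 2 * r_e\<^sup>2 + 8 * r_e + 1"
proof -
  interpret connected_edge_weighted_graph G w
    using assms(1,2)
    by (simp add: connected_edge_weighted_graph_def connected_edge_weighted_graph_axioms_def)
  obtain xs where xs: "fps_run G w xs" "length xs = k" "S = set xs"
    using assms(10) by (auto simp: fps_output_def)
  have T: "S_opt \<subseteq> verts G" "card S_opt = k"
    using assms(11) by (auto simp: optimal_sources_def is_arg_min_def)
  then have "S_opt \<noteq> {}"
    using assms(8) by auto
  then have le: "stretch G w S \<le> 2 * r_e * stretch G w S_opt + 2 * r_e + 1"
    using fps_stretch_le[OF assms(3,4,6) xs(1)] T xs(2,3) assms(7) by simp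
  \<comment> \<open>It remains to weaken the linear bound: \<open>r_e \<ge> 1\<close> allows
    \<open>r_e\<close> to be replaced by its square in front of the optimal stretch, and the
    additive terms only grow.\<close>
  have "1 \<le> r_e"
    using assms(4,5,7) by simp
  then have "r_e \<le> r_e\<^sup>2"
    by (simp add: self_le_power)
  then have "r_e * stretch G w S_opt \<le> r_e\<^sup>2 * stretch G w S_opt"
    using stretch_nonneg[OF assms(3) T(1) \<open>S_opt \<noteq> {}\<close>] by (intro mult_right_mono) auto
  then show ?thesis
    using le \<open>1 \<le> r_e\<close> \<open>r_e \<le> r_e\<^sup>2\<close> by linarith
qed

end
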